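(* Let $\ell\in\mathbb{Z}$. Then for all integers $n\ge 0$: (a) for every integer $m\ge 1$, $$L_m(N,-1)\,A_n(2,2m,\ell,-1)=0;$$ (b) for every integer $m\ge 0$, $$\left(F_{m+1}(N,-1)-F_m(N,-1)\right)A_n(2,2m+1,\ell,-1)=0.$$
   Context: For integers $n\ge 0$, $k\ge1$, $m\ge 1$, $\ell\in\mathbb{Z}$ and nonzero complex $z$, define $$A_n(k,m,\ell,z)=\sum_{h\in\mathbb{Z}}\binom{n}{\left\lfloor \frac{n+mh+\ell}{k}\right\rfloor}z^h,$$ where $\binom{n}{r}=0$ for $r<0$ or $r>n$ (so the sum is finite). The Fibonacci polynomials are defined by $F_0(x,s)=0$, $F_1(x,s)=1$ and $F_n(x,s)=xF_{n-1}(x,s)+sF_{n-2}(x,s)$ for $n\ge2$. The Lucas polynomials are defined by $L_0(x,s)=2$, $L_1(x,s)=x$ and $L_n(x,s)=xL_{n-1}(x,s)+sL_{n-2}(x,s)$ for $n\ge2$. $N$ denotes the shift operator on sequences in the index $n$: $N^iA_n=A_{n+i}$; for a polynomial $p(t)=\sum_i c_it^i$ one has $p(N)A_n=\sum_i c_iA_{n+i}$. *)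

theory Defs
  imports Complex_Main "HOL-Library.Groups_Big_Fun" "HOL-Computational_Algebra.Polynomial"
begin

definition binom_int :: "nat \<Rightarrow> int \<Rightarrow> nat" where
  "binom_int n r = (if r < 0 then 0 else n choose nat r)"

text \<open>\<^const>\<open>Sum_any\<close> sums over the support of its argument, and is 0 on infinite support;
  \<open>finite_support_A\<close> below shows that the support is finite for the intended parameters.\<close>

definition A :: "nat \<Rightarrow> nat \<Rightarrow> nat \<Rightarrow> int \<Rightarrow> complex \<Rightarrow> complex" where
  "A n k m l z =
     Sum_any (\<lambda>h::int. of_nat (binom_int n \<lfloor>real_of_int (int n + int m * h + l) / real k\<rfloor>) * z powi h)"

lemma finite_support_A:
  assumes "k \<ge> 1" "m \<ge> 1"
  shows "finite {h::int. of_nat (binom_int n \<lfloor>real_of_int (int n + int m * h + l) / real k\<rfloor>) * (z::complex) powi h \<noteq> 0}"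
proof (rule finite_subset)
  define B where "B = int n + \<bar>l\<bar> + int k * (int n + 1)"
  show "finite {-B..B}" by simp
  show "{h::int. of_nat (binom_int n \<lfloor>real_of_int (int n + int m * h + l) / real k\<rfloor>) * z powi h \<noteq> 0} \<subseteq> {-B..B}"
  proof
    fix h :: int
    define r where "r = (int n + int m * h + l) div int k"
    have fl: "\<lfloor>real_of_int (int n + int m * h + l) / real k\<rfloor> = r"
      unfolding r_def by (metis floor_divide_of_int_eq of_int_of_nat_eq)
    assume "h \<in> {h::int. of_nat (binom_int n \<lfloor>real_of_int (int n + int m * h + l) / real k\<rfloor>) * z powi h \<noteq> 0}"
    then have "binom_int n r \<noteq> 0" unfolding mem_Collect_eq fl by (metis mult_zero_left of_nat_0)
    then have r: "0 \<le> r" "r \<le> int n"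
      by (auto simp: binom_int_def not_less split: if_splits)
    have e: "int n + int m * h + l = int k * r + (int n + int m * h + l) mod int k"
      unfolding r_def by simp
    have md: "0 \<le> (int n + int m * h + l) mod int k" "(int n + int m * h + l) mod int k < int k"
      using assms by auto
    have kr: "0 \<le> int k * r" "int k * r \<le> int k * int n"
      using r by (simp_all add: mult_left_mono)
    have mh: "\<bar>int m * h\<bar> \<le> B"
      using e md kr unfolding B_def distrib_left by linarith
    have "\<bar>h\<bar> \<le> int m * \<bar>h\<bar>"
      using assms by (simp add: mult_le_cancel_right1)
    with mh have "\<bar>h\<bar> \<le> B" by (simp add: abs_mult)
    then show "h \<in> {-B..B}" by auto
  qed
qed

text \<open>\<open>fib_poly n s\<close> and \<open>lucas_poly n s\<close> are \<open>F\<^sub>n(x, s)\<close> and \<open>L\<^sub>n(x, s)\<close> as polynomials in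
  \<open>x\<close> (the indeterminate \<open>[:0, 1:]\<close>), for an arbitrary value \<open>s\<close> in the coefficient ring.\<close>

fun fib_poly :: "nat \<Rightarrow> 'a::comm_ring_1 \<Rightarrow> 'a poly" where
  "fib_poly 0 s = 0"
| "fib_poly (Suc 0) s = 1"
| "fib_poly (Suc (Suc n)) s = [:0, 1:] * fib_poly (Suc n) s + smult s (fib_poly n s)"

fun lucas_poly :: "nat \<Rightarrow> 'a::comm_ring_1 \<Rightarrow> 'a poly" where
  "lucas_poly 0 s = 2"
| "lucas_poly (Suc 0) s = [:0, 1:]"
| "lucas_poly (Suc (Suc n)) s = [:0, 1:] * lucas_poly (Suc n) s + smult s (lucas_poly n s)"

text \<open>\<open>apply_shift p a\<close> is the sequence \<open>p(N) a\<close>, where \<open>N\<close> is the shift \<open>(N a) n = a (n + 1)\<close>.\<close>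

definition apply_shift :: "'a::comm_ring_1 poly \<Rightarrow> (nat \<Rightarrow> 'a) \<Rightarrow> nat \<Rightarrow> 'a" where
  "apply_shift p a n = (\<Sum>i\<le>degree p. coeff p i * a (n + i))"

end

theory Submission imports Defs begin

text \<open>Fix \<open>k = 2\<close>, \<open>z = -1\<close> and write \<open>a\<^sub>n(l) = A\<^sub>n(2, M, l, -1)\<close>. Pascal's rule gives
  \<open>a\<^sub>n\<^sub>+\<^sub>1(l) = a\<^sub>n(l + 1) + a\<^sub>n(l - 1)\<close>, so on these sequences \<open>N\<close> acts as \<open>S + S\<^sup>-\<^sup>1\<close> with \<open>S\<close> the
  shift in \<open>l\<close>. Hence \<open>L\<^sub>m(N, -1)\<close> acts as \<open>S\<^sup>m + S\<^sup>-\<^sup>m\<close>, and \<open>P = F\<^sub>m\<^sub>+\<^sub>1(N, -1) - F\<^sub>m(N, -1)\<close> satisfies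
  \<open>(1 + S) P = S\<^sup>m\<^sup>+\<^sup>1 + S\<^sup>-\<^sup>m\<close>. Since \<open>a\<^sub>n(l + M) = - a\<^sub>n(l)\<close>, both right-hand sides annihilate
  \<open>a\<^sub>n\<close>, for \<open>M = 2m\<close> and \<open>M = 2m + 1\<close> respectively. This proves (a) and shows that \<open>P a\<^sub>n\<close> changes
  sign under \<open>S\<close>; the symmetry \<open>a\<^sub>n(1 - l) = a\<^sub>n(l)\<close> then forces \<open>P a\<^sub>n = 0\<close>.\<close>

text \<open>Allows one common summation bound for polynomials of different degrees.\<close>

lemma apply_shift_eq_sum:
  assumes "degree p \<le> d"
  shows "apply_shift p a n = (\<Sum>i\<le>d. coeff p i * a (n + i))"
  unfolding apply_shift_def
  by (rule sum.mono_neutral_left) (use assms in \<open>auto simp: coeff_eq_0\<close>)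

lemma apply_shift_diff: "apply_shift (p - q) a n = apply_shift p a n - apply_shift q a n"
proof -
  let ?d = "max (degree p) (degree q)"
  have "degree (p - q) \<le> ?d" by (rule degree_diff_le_max)
  then show ?thesis
    by (simp add: apply_shift_eq_sum[of _ ?d] sum_subtractf algebra_simps)
qed

lemma apply_shift_add_seq:
  "apply_shift p (\<lambda>j. a j + b j) n = apply_shift p a n + apply_shift p b n"
  by (simp add: apply_shift_def algebra_simps sum.distrib)

lemma apply_shift_X_mult: "apply_shift ([:0, 1:] * p) a n = apply_shift p a (Suc n)"
proof -
  have "degree ([:0, 1:] * p) \<le> Suc (degree p)"
    by (simp add: degree_pCons_le)
  then have "apply_shift ([:0, 1:] * p) a n
      = (\<Sum>i\<le>Suc (degree p). coeff ([:0, 1:] * p) i * a (n + i))"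
    by (rule apply_shift_eq_sum)
  also have "\<dots> = apply_shift p a (Suc n)"
    by (subst sum.atMost_Suc_shift) (simp add: apply_shift_def)
  finally show ?thesis .
qed

text \<open>Both sides satisfy \<open>x (m + 2) = N x (m + 1) - x m\<close>, as \<open>N\<close>
  acts on \<open>u\<close> as \<open>S + S\<^sup>-\<^sup>1\<close>.\<close>

lemma apply_shift_lucas_poly:
  fixes u :: "nat \<Rightarrow> int \<Rightarrow> 'a::comm_ring_1"
  assumes "\<And>n l. u (Suc n) l = u n (l + 1) + u n (l - 1)"
  shows "apply_shift (lucas_poly m (-1)) (\<lambda>j. u j l) n = u n (l + int m) + u n (l - int m)"
proof (induction m arbitrary: n rule: induct_nat_012)
  case 0
  show ?case
    using mult_2[of "u n l"] by (simp add: apply_shift_def numeral_poly)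
next
  case 1
  show ?case
    using apply_shift_X_mult[of 1 "\<lambda>j. u j l" n] by (simp add: apply_shift_def assms)
next
  case (ge2 m)
  have "lucas_poly (Suc (Suc m)) (-1) = [:0, 1:] * lucas_poly (Suc m) (-1) - lucas_poly m (-1 :: 'a)"
    by simp
  then show ?case
    by (simp only: apply_shift_diff apply_shift_X_mult ge2 assms) (simp add: algebra_simps)
qed

lemma apply_shift_fib_poly_diff:
  fixes u :: "nat \<Rightarrow> int \<Rightarrow> 'a::comm_ring_1"
  assumes "\<And>n l. u (Suc n) l = u n (l + 1) + u n (l - 1)"
  shows "apply_shift (fib_poly (Suc m) (-1) - fib_poly m (-1)) (\<lambda>j. u j l + u j (l + 1)) n
    = u n (l + int m + 1) + u n (l - int m)"
proof (induction m arbitrary: n rule: induct_nat_012)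
  case 0
  show ?case by (simp add: apply_shift_def)
next
  case 1
  have "fib_poly (Suc (Suc 0)) (-1) - fib_poly (Suc 0) (-1) = [:0, 1:] * 1 - (1 :: 'a poly)"
    by simp
  then show ?case
    by (simp only: apply_shift_diff apply_shift_X_mult) (simp add: apply_shift_def assms algebra_simps)
next
  case (ge2 m)
  \<comment> \<open>The recurrence is linear, so differences of consecutive terms satisfy it
    too.\<close>
  have "fib_poly (Suc (Suc (Suc m))) (-1) - fib_poly (Suc (Suc m)) (-1)
      = [:0, 1:] * (fib_poly (Suc (Suc m)) (-1) - fib_poly (Suc m) (-1))
        - (fib_poly (Suc m) (-1) - fib_poly m (-1 :: 'a))"
    by (simp add: algebra_simps)
  then show ?case
    by (simp only: apply_shift_diff[of "_ * _"] apply_shift_X_mult ge2 assms) (simp add: algebra_simps)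
qed

text \<open>The value 0 at negative \<open>r\<close> keeps Pascal's rule valid at
  \<open>r = 0\<close>.\<close>

lemma binom_int_Suc: "binom_int (Suc n) r = binom_int n r + binom_int n (r - 1)"
proof (cases "r \<ge> 1")
  case True
  then have "nat r = Suc (nat (r - 1))" by simp
  with True show ?thesis by (simp add: binom_int_def)
qed (auto simp: binom_int_def not_le)

lemma binom_int_symmetric: "binom_int n (int n - r) = binom_int n r"
proof (cases "0 \<le> r \<and> r \<le> int n")
  case True
  then have "nat (int n - r) = n - nat r" "nat r \<le> n" by auto
  with True show ?thesis
    using binomial_symmetric[of "nat r" n] by (simp add: binom_int_def)
qed (auto simp: binom_int_def)

lemma floor_of_int_divide_2: "\<lfloor>real_of_int i / real 2\<rfloor> = i div 2"
  using floor_divide_of_int_eq[of i 2] by simp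

lemma A_2_eq: "A n 2 M l z = Sum_any (\<lambda>h. of_nat (binom_int n ((int n + int M * h + l) div 2)) * z powi h)"
  by (simp only: A_def floor_of_int_divide_2)

lemma finite_support_A_2:
  assumes "M \<ge> 1"
  shows "finite {h. of_nat (binom_int n ((int n + int M * h + l) div 2)) * (z::complex) powi h \<noteq> 0}"
  using finite_support_A[of 2 M n l z] assms by (simp only: floor_of_int_divide_2)

lemma A_2_Suc:
  assumes "M \<ge> 1"
  shows "A (Suc n) 2 M l z = A n 2 M (l + 1) z + A n 2 M (l - 1) z"
proof -
  \<comment> \<open>Lowering the quotient by 1 lowers the numerator by k = 2, taking
    \<open>l + 1\<close> to \<open>l - 1\<close>.\<close>
  have "(int (Suc n) + i + l) div 2 = (int n + i + (l + 1)) div 2"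
    "(int (Suc n) + i + l) div 2 - 1 = (int n + i + (l - 1)) div 2" for i
    by presburger+
  then show ?thesis
    unfolding A_2_eq binom_int_Suc of_nat_add distrib_right
    by (simp only:) (rule Sum_any.distrib finite_support_A_2 assms)+
qed

text \<open>Replacing h by h + 1 adds \<open>M\<close> to the numerator and releases one factor
  \<open>z\<close>.\<close>

lemma A_add_period:
  assumes "k \<ge> 1" "M \<ge> 1" "z \<noteq> 0"
  shows "A n k M (l + int M) z = A n k M l z / z"
proof -
  let ?f = "\<lambda>l h. of_nat (binom_int n \<lfloor>real_of_int (int n + int M * h + l) / real k\<rfloor>) * z powi h"
  have "A n k M l z = Sum_any (\<lambda>h. ?f l (h + 1))"
    unfolding A_def by (rule Sum_any.reindex_cong[of "\<lambda>h. h + 1"])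
      (auto intro: bij_betw_byWitness[of _ "\<lambda>h. h - 1"])
  also have "\<dots> = Sum_any (\<lambda>h. ?f (l + int M) h * z)"
    using assms by (intro Sum_any.cong) (simp add: power_int_add_1 algebra_simps)
  also have "\<dots> = A n k M (l + int M) z * z"
    unfolding A_def by (rule Sum_any_left_distrib [symmetric]) (rule finite_support_A[OF assms(1,2)])
  finally show ?thesis using assms by simp
qed

lemma A_2_minus_one_reflect: "A n 2 M (1 - l) (-1) = A n 2 M l (-1)"
proof -
  let ?f = "\<lambda>l h. of_nat (binom_int n ((int n + int M * h + l) div 2)) * (-1 :: complex) powi h"
  have "?f (1 - l) (- h) = ?f l h" for h
  proof -
    \<comment> \<open>For x = n + Mh + l this is n - floor(x/2) = floor((2n + 1 - x)/2); the 1 is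
      the source of \<open>1 - l\<close>.\<close>
    have "(int n + int M * - h + (1 - l)) div 2 = int n - (int n + int M * h + l) div 2"
      by (simp only: mult_minus_right)
    then show ?thesis by (simp add: binom_int_symmetric power_int_minus_one_minus)
  qed
  then have "A n 2 M l (-1) = Sum_any (\<lambda>h. ?f (1 - l) (- h))"
    by (simp only: A_2_eq)
  also have "\<dots> = A n 2 M (1 - l) (-1)"
    unfolding A_2_eq by (rule Sum_any.reindex_cong[of uminus, symmetric]) (auto intro: bij_uminus)
  finally show ?thesis ..
qed

theorem theorem4:
  fixes l :: int and n :: nat
  shows "(\<forall>m::nat. m \<ge> 1 \<longrightarrow>
            apply_shift (lucas_poly m (-1)) (\<lambda>j. A j 2 (2 * m) l (-1)) n = 0) \<and>
         (\<forall>m::nat.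
            apply_shift (fib_poly (m + 1) (-1) - fib_poly m (-1)) (\<lambda>j. A j 2 (2 * m + 1) l (-1)) n = 0)"
proof (intro conjI allI impI)
  fix m :: nat
  assume "m \<ge> 1"
  then have "apply_shift (lucas_poly m (-1)) (\<lambda>j. A j 2 (2 * m) l (-1)) n
      = A n 2 (2 * m) (l + int m) (-1) + A n 2 (2 * m) (l - int m) (-1)"
    by (intro apply_shift_lucas_poly A_2_Suc) simp
  \<comment> \<open>The two arguments differ by exactly \<open>2 * m\<close>, so the terms
    cancel.\<close>
  also have "\<dots> = 0"
    using A_add_period[of 2 "2 * m" "-1" n "l - int m"] \<open>m \<ge> 1\<close> by (simp add: add.commute)
  finally show "apply_shift (lucas_poly m (-1)) (\<lambda>j. A j 2 (2 * m) l (-1)) n = 0" .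
next
  fix m :: nat
  define g where
    "g l = apply_shift (fib_poly (m + 1) (-1) - fib_poly m (-1)) (\<lambda>j. A j 2 (2 * m + 1) l (-1)) n"
    for l
  have sign: "g (l + 1) = - g l" for l
  proof -
    have "g l + g (l + 1) = A n 2 (2 * m + 1) (l + int m + 1) (-1) + A n 2 (2 * m + 1) (l - int m) (-1)"
      unfolding g_def apply_shift_add_seq[symmetric] Suc_eq_plus1[symmetric]
      by (intro apply_shift_fib_poly_diff A_2_Suc) simp
    also have "\<dots> = 0"
      using A_add_period[of 2 "2 * m + 1" "-1" n "l - int m"] by (simp add: algebra_simps)
    finally show ?thesis by (simp add: eq_neg_iff_add_eq_0 add.commute)
  qed
  \<comment> \<open>The reflection swaps the neighbours 0 and 1, where \<open>sign\<close> gives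
    opposite values.\<close>
  have "g 1 = g 0"
    using A_2_minus_one_reflect[of _ "2 * m + 1" 0] by (simp add: g_def)
  with sign[of 0] have "g 0 = 0" by simp
  have "g l = 0"
  proof (induction l rule: int_induct[of _ 0])
    case base
    show ?case by fact
  next
    case (step1 i)
    then show ?case by (simp add: sign)
  next
    case (step2 i)
    then show ?case using sign[of "i - 1"] by simp
  qed
  then show "apply_shift (fib_poly (m + 1) (-1) - fib_poly m (-1)) (\<lambda>j. A j 2 (2 * m + 1) l (-1)) n = 0"
    by (simp only: g_def)
qed

end
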